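(* Let $X=\begin{pmatrix}w&x\\ y&z\end{pmatrix}\in M_2(\mathbb{N}_0)^\bullet$ be such that $w\le z$, $z<x$, $z<y$, and $\gcd(wz,xy)=1$. If $x>2(z-1)(w-1)$ or $y>2(z-1)(w-1)$, then $X$ and all of its associates are atoms of $M_2(\mathbb{N}_0)^\bullet$.
   Context: $M_2(\mathbb{N}_0)^\bullet$ is the semigroup, under matrix multiplication, of $2\times 2$ matrices with non-negative integer entries and non-zero determinant. Its only units are $I=\begin{pmatrix}1&0\\0&1\end{pmatrix}$ and $J=\begin{pmatrix}0&1\\1&0\end{pmatrix}$. An atom is a non-unit $X\in M_2(\mathbb{N}_0)^\bullet$ such that whenever $X=AB$ with $A,B\in M_2(\mathbb{N}_0)^\bullet$, at least one of $A,B$ is a unit. The associates of $X$ are $X$, $JX$, $XJ$ and $JXJ$. The inequalities are between integers (differences such as $w-1$ are taken in $\mathbb{Z}$), and $\gcd(n,0)=n$. *)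

theory Defs
  imports "HOL-Analysis.Determinants" "HOL-Algebra.Group"
begin

text \<open>
  The determinant is only available over commutative rings, so the entries are
  mapped to the integers before it is taken.
\<close>

definition M2N0 :: "(nat^2^2) monoid" where
  "M2N0 = \<lparr>carrier = {A. det (map_matrix int A) \<noteq> 0}, mult = (**), one = mat 1\<rparr>"

text \<open>
  The notion \<open>irreducible\<close> of HOL-Algebra is built on one-sided divisibility and is
  intended for commutative monoids; for the non-commutative case we define atoms
  directly in terms of two-factor factorizations.
\<close>

definition is_atom :: "('a, 'b) monoid_scheme \<Rightarrow> 'a \<Rightarrow> bool" where
  "is_atom G x \<longleftrightarrow> x \<in> carrier G \<and> x \<notin> Units G \<and>
     (\<forall>a \<in> carrier G. \<forall>b \<in> carrier G. x = a \<otimes>\<^bsub>G\<^esub> b \<longrightarrow> a \<in> Units G \<or> b \<in> Units G)"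

definition mat2 :: "'a::zero \<Rightarrow> 'a \<Rightarrow> 'a \<Rightarrow> 'a \<Rightarrow> 'a^2^2" where
  "mat2 a b c d = vector [vector [a, b], vector [c, d]]"

definition J :: "nat^2^2" where
  "J = mat2 0 1 1 0"

definition associates :: "nat^2^2 \<Rightarrow> (nat^2^2) set" where
  "associates X = {X, J ** X, X ** J, J ** X ** J}"

lemma mat2_nth [simp]:
  "mat2 a b c d $ 1 $ 1 = a" "mat2 a b c d $ 1 $ 2 = b"
  "mat2 a b c d $ 2 $ 1 = c" "mat2 a b c d $ 2 $ 2 = d"
  by (simp_all add: mat2_def)

lemma mat2_cases: obtains a b c d where "A = mat2 a b c d"
proof
  show "A = mat2 (A $ 1 $ 1) (A $ 1 $ 2) (A $ 2 $ 1) (A $ 2 $ 2)"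
    by (simp add: vec_eq_iff forall_2)
qed

lemma mat2_mult: "mat2 a b c d ** mat2 p q r s =
    mat2 (a * p + b * r) (a * q + b * s) (c * p + d * r) (c * q + d * (s :: 'a::semiring_1))"
  by (simp add: vec_eq_iff forall_2 matrix_matrix_mult_def sum_2)

lemma mat2_eq_iff: "mat2 a b c d = mat2 p q r s \<longleftrightarrow> a = p \<and> b = q \<and> c = r \<and> d = s"
  by (auto simp: vec_eq_iff forall_2)

lemma mat_1_eq_mat2: "(mat 1 :: 'a::semiring_1^2^2) = mat2 1 0 0 1"
  by (simp add: vec_eq_iff forall_2 mat_def)

lemma mat2_in_carrier_iff: "mat2 a b c d \<in> carrier M2N0 \<longleftrightarrow> a * d \<noteq> b * c"
  by (simp add: M2N0_def det_2 map_matrix_def flip: of_nat_mult)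

lemma det_map_matrix_int_mult:
  "det (map_matrix int (A ** B)) = det (map_matrix int A) * det (map_matrix int (B :: nat^2^2))"
proof -
  have "map_matrix int (A ** B) = map_matrix int A ** map_matrix int B"
    by (simp add: vec_eq_iff forall_2 matrix_matrix_mult_def sum_2 map_matrix_def)
  then show ?thesis by (simp add: det_mul)
qed

lemma monoid_M2N0: "monoid M2N0"
proof
  show "\<one>\<^bsub>M2N0\<^esub> \<in> carrier M2N0"
  proof -
    have "(mat 1 :: nat^2^2) \<in> carrier M2N0"
      unfolding mat_1_eq_mat2 mat2_in_carrier_iff by simp
    then show ?thesis by (simp add: M2N0_def)
  qed
qed (auto simp: M2N0_def det_map_matrix_int_mult matrix_mul_assoc simp del: One_nat_def)

lemma Units_M2N0: "Units M2N0 = {mat 1, J}"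
proof (intro equalityI subsetI)
  fix X assume "X \<in> Units M2N0"
  then obtain Y where Y: "X ** Y = mat 1" "Y ** X = mat 1"
    by (auto simp: Units_def M2N0_def)
  obtain a b c d where X: "X = mat2 a b c d" by (rule mat2_cases)
  obtain p q r s where Y': "Y = mat2 p q r s" by (rule mat2_cases)
  from Y have e: "a * p + b * r = 1" "a * q + b * s = 0" "c * p + d * r = 0" "c * q + d * s = 1"
    "p * a + q * c = 1" "p * b + q * d = 0" "r * a + s * c = 0" "r * b + s * d = 1"
    unfolding X Y' mat_1_eq_mat2 mat2_mult mat2_eq_iff by blast+
  show "X \<in> {mat 1, J}"
  proof (cases "p = 0")
    case True
    with e have "X = J" unfolding X J_def mat2_eq_iff by auto
    then show ?thesis by simp
  next
    case False
    with e have "X = mat 1" unfolding X mat_1_eq_mat2 mat2_eq_iff by auto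
    then show ?thesis by simp
  qed
next
  fix X assume X: "X \<in> {mat 1, J}"
  have "X ** X = mat 1"
    using X unfolding J_def mat_1_eq_mat2 by (auto simp: mat2_mult)
  moreover have "X \<in> carrier M2N0"
    using X unfolding J_def mat_1_eq_mat2 by (auto simp: mat2_in_carrier_iff)
  ultimately show "X \<in> Units M2N0" by (auto simp: Units_def M2N0_def)
qed

end

theory Submission
  imports Defs
begin

text \<open>
  Suppose \<open>X = A B\<close>.  The rows and columns of \<open>X\<close> are coprime pairs and its off-diagonal entries
  exceed its diagonal ones.  There are two cases.

  If a factor has a zero entry, that factor is a unit.  For example, when \<open>A\<close> has first row
  \<open>(0, b)\<close>, the number \<open>b\<close> divides the coprime first row of \<open>X\<close>, so \<open>b = 1\<close> and the second row of
  \<open>B\<close> is the first row of \<open>X\<close>.  A nonzero lower right entry of \<open>A\<close> would now make \<open>z \<ge> x\<close>, so it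
  vanishes, the lower left entry divides the coprime second row of \<open>X\<close>, and \<open>A = J\<close>
  (\<open>left_factor_eq_J\<close>).  The other seven positions of the zero reduce to this one: insert \<open>J J\<close>
  between the factors, pass from \<open>X\<close> to \<open>J X J\<close>, or transpose the product.

  If all entries of both factors are positive, each entry of \<open>X\<close> is a sum of two positive products.
  Every entry in the first row of \<open>A\<close> occurs as a factor in \<open>w\<close> and hence is at most \<open>w - 1\<close>; every
  entry in the second column of \<open>B\<close> is likewise at most \<open>z - 1\<close>.  Hence \<open>x \<le> 2 (z - 1) (w - 1)\<close>,
  and the same bound holds for \<open>y\<close>, so the size hypothesis excludes this case.

  Associates are obtained by multiplying with units, and this preserves atoms in every monoid.
\<close>

section \<open>Atoms and units\<close>

lemma (in monoid) inv_unit_mult_cancel: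
  assumes u: "u \<in> Units G" and x: "x \<in> carrier G"
  shows "inv u \<otimes> (u \<otimes> x) = x" "x \<otimes> u \<otimes> inv u = x"
proof -
  have u': "u \<in> carrier G" "inv u \<in> carrier G"
    using u by auto
  show "inv u \<otimes> (u \<otimes> x) = x"
    unfolding m_assoc[OF u'(2,1) x, symmetric] Units_l_inv[OF u] using x by (rule l_one)
  show "x \<otimes> u \<otimes> inv u = x"
    unfolding m_assoc[OF x u'] Units_r_inv[OF u] using x by (rule r_one)
qed

lemma (in monoid) unit_mult_in_Units_iff:
  assumes u: "u \<in> Units G" and x: "x \<in> carrier G"
  shows "u \<otimes> x \<in> Units G \<longleftrightarrow> x \<in> Units G" "x \<otimes> u \<in> Units G \<longleftrightarrow> x \<in> Units G"
proof -
  have iu: "inv u \<in> Units G"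
    using u by (rule Units_inv_Units)
  show "u \<otimes> x \<in> Units G \<longleftrightarrow> x \<in> Units G"
    using Units_m_closed[OF u, of x] Units_m_closed[OF iu, of "u \<otimes> x"]
    unfolding inv_unit_mult_cancel(1)[OF u x] by blast
  show "x \<otimes> u \<in> Units G \<longleftrightarrow> x \<in> Units G"
    using Units_m_closed[OF _ u, of x] Units_m_closed[OF _ iu, of "x \<otimes> u"]
    unfolding inv_unit_mult_cancel(2)[OF u x] by blast
qed

text \<open>
  A factorization \<open>u x = a b\<close> becomes \<open>x = (inv u a) b\<close>, whose first factor is a unit exactly when
  \<open>a\<close> is.
\<close>

lemma (in monoid) is_atom_unit_mult:
  assumes "is_atom G x" and u: "u \<in> Units G"
  shows "is_atom G (u \<otimes> x)" "is_atom G (x \<otimes> u)"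
proof -
  have x: "x \<in> carrier G" "x \<notin> Units G"
    and atom: "\<And>a b. a \<in> carrier G \<Longrightarrow> b \<in> carrier G \<Longrightarrow> x = a \<otimes> b \<Longrightarrow>
      a \<in> Units G \<or> b \<in> Units G"
    using assms(1) by (auto simp: is_atom_def)
  have u': "u \<in> carrier G" "inv u \<in> carrier G" "inv u \<in> Units G"
    using u by auto
  have "a \<in> Units G \<or> b \<in> Units G"
    if a: "a \<in> carrier G" and b: "b \<in> carrier G" and eq: "u \<otimes> x = a \<otimes> b" for a b
  proof -
    have "x = inv u \<otimes> a \<otimes> b"
      using inv_unit_mult_cancel(1)[OF u x(1)] unfolding eq m_assoc[OF u'(2) a b] by (rule sym)
    from atom[OF _ b this] show ?thesis
      using unit_mult_in_Units_iff(1)[OF u'(3) a] u' a by blast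
  qed
  then show "is_atom G (u \<otimes> x)"
    using unit_mult_in_Units_iff(1)[OF u x(1)] x u' unfolding is_atom_def by blast
  have "a \<in> Units G \<or> b \<in> Units G"
    if a: "a \<in> carrier G" and b: "b \<in> carrier G" and eq: "x \<otimes> u = a \<otimes> b" for a b
  proof -
    have "x = a \<otimes> (b \<otimes> inv u)"
      using inv_unit_mult_cancel(2)[OF u x(1)] unfolding eq m_assoc[OF a b u'(2)] by (rule sym)
    from atom[OF a _ this] show ?thesis
      using unit_mult_in_Units_iff(2)[OF u'(3) b] u' b by blast
  qed
  then show "is_atom G (x \<otimes> u)"
    using unit_mult_in_Units_iff(2)[OF u x(1)] x u' unfolding is_atom_def by blast
qed

lemma is_atom_M2N0_associates:
  assumes "is_atom M2N0 X" and "Y \<in> associates X"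
  shows "is_atom M2N0 Y"
proof -
  have J: "J \<in> Units M2N0" by (simp add: Units_M2N0)
  have left: "is_atom M2N0 (J ** Z)" if "is_atom M2N0 Z" for Z
    using monoid.is_atom_unit_mult(1)[OF monoid_M2N0 that J] by (simp add: M2N0_def)
  have right: "is_atom M2N0 (Z ** J)" if "is_atom M2N0 Z" for Z
    using monoid.is_atom_unit_mult(2)[OF monoid_M2N0 that J] by (simp add: M2N0_def)
  show ?thesis
    using assms by (auto simp: associates_def intro: left right)
qed

lemma mat2_in_Units_iff:
  "mat2 a b c d \<in> Units M2N0 \<longleftrightarrow>
     a = 1 \<and> b = 0 \<and> c = 0 \<and> d = 1 \<or> a = 0 \<and> b = 1 \<and> c = 1 \<and> d = 0"
  by (simp add: Units_M2N0 J_def mat_1_eq_mat2 mat2_eq_iff del: One_nat_def)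

section \<open>Factors with a zero entry\<close>

text \<open>
  An entry of the left factor whose neighbour in its row vanishes divides a whole row of the product,
  so coprimality of that row makes the entry \<open>1\<close>.  This applies first to \<open>b\<close> and, once \<open>z < x\<close> has
  forced \<open>d = 0\<close>, to \<open>c\<close>.
\<close>

lemma left_factor_eq_J:
  fixes w x y z :: nat
  assumes eq: "mat2 0 b c d ** mat2 p q r s = mat2 w x y z"
    and rows: "coprime w x" "coprime y z" and less: "z < x"
  shows "mat2 0 b c d = J"
proof -
  have w: "w = b * r" and x: "x = b * s" and y: "y = c * p + d * r" and z: "z = c * q + d * s"
    using eq by (auto simp: mat2_mult mat2_eq_iff)
  have b: "b = 1"
    using rows(1) by (simp add: w x)
  have d: "d = 0"
  proof (rule ccontr)
    assume "d \<noteq> 0"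
    then have "s \<le> d * s" by simp
    also have "\<dots> \<le> z" by (simp add: z)
    finally show False using less by (simp add: x b)
  qed
  have "c = 1"
    using rows(2) by (simp add: y z d)
  with b d show ?thesis by (simp add: J_def)
qed

text \<open>
  Exchanging the columns of the left factor together with the rows of the right factor leaves the
  product \<open>X\<close> unchanged and moves the zero within its row.  To move it to the other row, the rows of
  the left and the columns of the right factor are exchanged, which turns \<open>X\<close> into \<open>J X J\<close>: the diagonal and the off-diagonal entries are
  swapped among themselves, so \<open>w < y\<close> takes the place of \<open>z < x\<close>.
\<close>

lemma left_factor_unit_if_zero:
  fixes w x y z :: nat
  assumes eq: "mat2 a b c d ** mat2 p q r s = mat2 w x y z"
    and rows: "coprime w x" "coprime y z" and less: "z < x" "w < y"
    and zero: "a = 0 \<or> b = 0 \<or> c = 0 \<or> d = 0"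
  shows "mat2 a b c d \<in> Units M2N0"
proof -
  have rows': "coprime z y" "coprime x w"
    using rows by (simp_all add: coprime_commute)
  from zero consider "a = 0" | "b = 0" | "c = 0" | "d = 0" by blast
  then show ?thesis
  proof cases
    case 1
    then show ?thesis
      using left_factor_eq_J[of b c d p q r s w x y z] eq rows less
      by (simp add: mat2_in_Units_iff J_def mat2_eq_iff)
  next
    case 2
    have "mat2 b a d c ** mat2 r s p q = mat2 w x y z"
      using eq by (simp add: mat2_mult mat2_eq_iff add.commute)
    then show ?thesis
      using left_factor_eq_J[of a d c r s p q w x y z] 2 rows less
      by (simp add: mat2_in_Units_iff J_def mat2_eq_iff)
  next
    case 3
    have "mat2 c d a b ** mat2 q p s r = mat2 z y x w"
      using eq by (simp add: mat2_mult mat2_eq_iff)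
    then show ?thesis
      using left_factor_eq_J[of d a b q p s r z y x w] 3 rows' less
      by (simp add: mat2_in_Units_iff J_def mat2_eq_iff)
  next
    case 4
    have "mat2 d c b a ** mat2 s r q p = mat2 z y x w"
      using eq by (simp add: mat2_mult mat2_eq_iff add.commute)
    then show ?thesis
      using left_factor_eq_J[of c b a s r q p z y x w] 4 rows' less
      by (simp add: mat2_in_Units_iff J_def mat2_eq_iff)
  qed
qed

text \<open>
  Transposition turns the right factor into the left one.  It exchanges \<open>x\<close> and \<open>y\<close>, so the
  columns of the product have to be coprime instead of its rows.
\<close>

lemma right_factor_unit_if_zero:
  fixes w x y z :: nat
  assumes eq: "mat2 a b c d ** mat2 p q r s = mat2 w x y z"
    and cols: "coprime w y" "coprime x z" and less: "z < y" "w < x"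
    and zero: "p = 0 \<or> q = 0 \<or> r = 0 \<or> s = 0"
  shows "mat2 p q r s \<in> Units M2N0"
proof -
  have "mat2 p r q s ** mat2 a c b d = mat2 w y x z"
    using eq by (simp add: mat2_mult mat2_eq_iff mult.commute)
  moreover have "p = 0 \<or> r = 0 \<or> q = 0 \<or> s = 0"
    using zero by blast
  ultimately have "mat2 p r q s \<in> Units M2N0"
    using cols less by (intro left_factor_unit_if_zero)
  then show ?thesis
    by (auto simp: mat2_in_Units_iff)
qed

section \<open>Products of positive matrices\<close>

text \<open>
  The gain of \<open>1\<close> over the trivial bound \<open>w\<close> comes from the other summand, which is positive.
\<close>

lemma summand_factors_bounded:
  fixes a b p r w :: nat
  assumes "w = a * p + b * r" and pos: "0 < a" "0 < b" "0 < p" "0 < r"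
  shows "int a \<le> int w - 1" "int b \<le> int w - 1" "int p \<le> int w - 1" "int r \<le> int w - 1"
proof -
  have "a \<le> a * p" "p \<le> a * p" "b \<le> b * r" "r \<le> b * r" "0 < a * p" "0 < b * r"
    using pos by simp_all
  with assms(1) show "int a \<le> int w - 1" "int b \<le> int w - 1" "int p \<le> int w - 1" "int r \<le> int w - 1"
    by linarith+
qed

text \<open>
  Each summand of \<open>x\<close> and of \<open>y\<close> pairs a factor of a summand of \<open>w\<close> with a factor of a summand
  of \<open>z\<close>, because \<open>x\<close> and \<open>w\<close> share a row of the left matrix and \<open>x\<close> and \<open>z\<close> a column of the
  right one, and the other way round for \<open>y\<close>.
\<close>

lemma positive_product_off_diagonal_le:
  fixes w x y z :: nat
  assumes eq: "mat2 a b c d ** mat2 p q r s = mat2 w x y z"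
    and pos: "0 < a" "0 < b" "0 < c" "0 < d" "0 < p" "0 < q" "0 < r" "0 < s"
  shows "int x \<le> 2 * (int z - 1) * (int w - 1)" "int y \<le> 2 * (int z - 1) * (int w - 1)"
proof -
  have w: "w = a * p + b * r" and x: "x = a * q + b * s"
    and y: "y = c * p + d * r" and z: "z = c * q + d * s"
    using eq by (auto simp: mat2_mult mat2_eq_iff)
  note bw = summand_factors_bounded[OF w pos(1,2,5,7)]
  note bz = summand_factors_bounded[OF z pos(3,4,6,8)]
  have "int a * int q \<le> (int w - 1) * (int z - 1)" "int b * int s \<le> (int w - 1) * (int z - 1)"
    "int c * int p \<le> (int z - 1) * (int w - 1)" "int d * int r \<le> (int z - 1) * (int w - 1)"
    using bw bz pos by (auto intro!: mult_mono)
  then show "int x \<le> 2 * (int z - 1) * (int w - 1)" "int y \<le> 2 * (int z - 1) * (int w - 1)"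
    by (simp_all add: x y algebra_simps)
qed

section \<open>The family of atoms\<close>

theorem corollary6p2:
  fixes w x y z :: nat and X :: "nat^2^2"
  assumes "X = mat2 w x y z"
    and "X \<in> carrier M2N0"
    and "w \<le> z" and "z < x" and "z < y"
    and "gcd (w * z) (x * y) = 1"
    and "int x > 2 * (int z - 1) * (int w - 1) \<or> int y > 2 * (int z - 1) * (int w - 1)"
  shows "\<forall>Y \<in> associates X. is_atom M2N0 Y"
proof -
  have "coprime (w * z) (x * y)"
    using assms(6) by (simp only: coprime_iff_gcd_eq_1)
  then have cop: "coprime w x" "coprime w y" "coprime x z" "coprime y z"
    by (simp_all add: coprime_commute)
  have less: "w < x" "w < y"
    using assms(3-5) by linarith+
  have "X \<notin> Units M2N0"
  proof
    assume "X \<in> Units M2N0"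
    \<comment> \<open>As \<open>x > 0\<close>, the unit would be \<open>J\<close>, but \<open>w = z = 0\<close> turns the size condition into \<open>1 > 2\<close>.\<close>
    then have "w = 0 \<and> x = 1 \<and> y = 1 \<and> z = 0"
      using assms(1,4) by (auto simp: mat2_in_Units_iff)
    with assms(7) show False by simp
  qed
  moreover have "A \<in> Units M2N0 \<or> B \<in> Units M2N0" if AB: "X = A ** B" for A B
  proof -
    obtain a b c d where A: "A = mat2 a b c d" by (rule mat2_cases)
    obtain p q r s where B: "B = mat2 p q r s" by (rule mat2_cases)
    have eq: "mat2 a b c d ** mat2 p q r s = mat2 w x y z"
      using AB assms(1) A B by simp
    consider "a = 0 \<or> b = 0 \<or> c = 0 \<or> d = 0" | "p = 0 \<or> q = 0 \<or> r = 0 \<or> s = 0"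
      | "0 < a" "0 < b" "0 < c" "0 < d" "0 < p" "0 < q" "0 < r" "0 < s"
      by blast
    then show ?thesis
    proof cases
      case 1
      then show ?thesis
        using left_factor_unit_if_zero[OF eq] cop assms(4) less A by blast
    next
      case 2
      then show ?thesis
        using right_factor_unit_if_zero[OF eq] cop assms(5) less B by blast
    next
      case 3
      with positive_product_off_diagonal_le[OF eq] assms(7) show ?thesis by linarith
    qed
  qed
  ultimately have "is_atom M2N0 X"
    using assms(2) by (simp add: is_atom_def) (simp add: M2N0_def)
  then show ?thesis
    using is_atom_M2N0_associates by blast
qed

end
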